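(* Let $\mathcal{S}=\langle\mathcal{L},\vdash\rangle$ be a logic, with $\mathcal{L}$ a formula algebra over a denumerable set of variables $V$, that satisfies monotonicity for trivial sets. If $\mathcal{S}$ is NF-paraconsistent, then its right variable inclusion companion $\mathcal{S}^r$ is also NF-paraconsistent.
   Context: A logic is a pair $\langle\mathcal{L},\vdash\rangle$ with $\vdash\,\subseteq\mathcal{P}(\mathcal{L})\times\mathcal{L}$, and $C_\vdash(\Gamma)=\{\alpha:\Gamma\vdash\alpha\}$. $\mathcal{L}$ is the formula algebra over a denumerable set $V$ of variables in a finite signature; a substitution is an endomorphism $\sigma$ of $\mathcal{L}$. $\mathrm{var}(\alpha)$ is the set of variables in $\alpha$; $\mathrm{var}(\Gamma)=\bigcup_{\alpha\in\Gamma}\mathrm{var}(\alpha)$. A set $\Gamma$ is $\mathcal{S}$-trivial if $C_\vdash(\Gamma)=\mathcal{L}$. $\mathcal{S}$ satisfies monotonicity for trivial sets if every superset of an $\mathcal{S}$-trivial set is $\mathcal{S}$-trivial. An $\mathcal{S}$-antitheorem is a set $\Sigma\subseteq\mathcal{L}$ such that $C_\vdash(\sigma(\Sigma))=\mathcal{L}$ for every substitution $\sigma$. $\mathcal{S}^r=\langle\mathcal{L},\vdash^r\rangle$ where $\Gamma\vdash^r\alpha$ iff either $\Gamma$ contains (as a subset) an $\mathcal{S}$-antitheorem, or $\Gamma\vdash\alpha$ and $\mathrm{var}(\alpha)\subseteq\mathrm{var}(\Gamma)$. A logic is NF-paraconsistent if there exists $\alpha\in\mathcal{L}$ such that $C_\vdash(\{\alpha,\beta\})\neq\mathcal{L}$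 for every $\beta\in\mathcal{L}$. *)

theory Defs
  imports "HOL-Library.Countable_Set" "HOL-Library.FuncSet"
begin

datatype (syms: 'f, vars: 'v) fm = Var 'v | Op 'f "('f, 'v) fm list"

text \<open>A signature is a set \<open>F\<close> of connectives with arities \<open>ar\<close>; \<open>formulas F ar V\<close> is the carrier of
  the formula algebra over the variables \<open>V\<close>. Connectives of arity 0 (constants) are allowed.\<close>

inductive_set formulas :: "'f set \<Rightarrow> ('f \<Rightarrow> nat) \<Rightarrow> 'v set \<Rightarrow> ('f, 'v) fm set"
  for F :: "'f set" and ar :: "'f \<Rightarrow> nat" and V :: "'v set" where
  Var: "x \<in> V \<Longrightarrow> Var x \<in> formulas F ar V"
| Op: "f \<in> F \<Longrightarrow> length ts = ar f \<Longrightarrow> \<forall>t\<in>set ts. t \<in> formulas F ar V \<Longrightarrow> Op f ts \<in> formulas F ar V"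

definition vars_set :: "('f, 'v) fm set \<Rightarrow> 'v set" where
  "vars_set \<Gamma> = (\<Union>\<alpha>\<in>\<Gamma>. vars \<alpha>)"

text \<open>Endomorphisms of the formula algebra. Only the values on \<open>formulas F ar V\<close> matter.\<close>

definition substitution ::
  "'f set \<Rightarrow> ('f \<Rightarrow> nat) \<Rightarrow> 'v set \<Rightarrow> (('f, 'v) fm \<Rightarrow> ('f, 'v) fm) \<Rightarrow> bool" where
  "substitution F ar V \<sigma> \<longleftrightarrow>
     \<sigma> \<in> formulas F ar V \<rightarrow> formulas F ar V \<and>
     (\<forall>f\<in>F. \<forall>ts\<in>lists (formulas F ar V). length ts = ar f \<longrightarrow>
        \<sigma> (Op f ts) = Op f (map \<sigma> ts))"

type_synonym 'a logic = "'a set \<times> ('a set \<times> 'a) set"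

definition is_logic :: "'a logic \<Rightarrow> bool" where
  "is_logic S \<longleftrightarrow> snd S \<subseteq> Pow (fst S) \<times> fst S"

definition Cn :: "'a logic \<Rightarrow> 'a set \<Rightarrow> 'a set" where
  "Cn S \<Gamma> = {\<alpha>. (\<Gamma>, \<alpha>) \<in> snd S}"

definition trivial_set :: "'a logic \<Rightarrow> 'a set \<Rightarrow> bool" where
  "trivial_set S \<Gamma> \<longleftrightarrow> \<Gamma> \<subseteq> fst S \<and> Cn S \<Gamma> = fst S"

definition monotone_for_trivial_sets :: "'a logic \<Rightarrow> bool" where
  "monotone_for_trivial_sets S \<longleftrightarrow>
     (\<forall>\<Gamma> \<Delta>. trivial_set S \<Gamma> \<longrightarrow> \<Gamma> \<subseteq> \<Delta> \<longrightarrow> \<Delta> \<subseteq> fst S \<longrightarrow> trivial_set S \<Delta>)"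

definition NF_paraconsistent :: "'a logic \<Rightarrow> bool" where
  "NF_paraconsistent S \<longleftrightarrow> (\<exists>\<alpha>\<in>fst S. \<forall>\<beta>\<in>fst S. Cn S {\<alpha>, \<beta>} \<noteq> fst S)"

definition antitheorem ::
  "'f set \<Rightarrow> ('f \<Rightarrow> nat) \<Rightarrow> 'v set \<Rightarrow> ('f, 'v) fm logic \<Rightarrow> ('f, 'v) fm set \<Rightarrow> bool" where
  "antitheorem F ar V S \<Sigma> \<longleftrightarrow>
     \<Sigma> \<subseteq> fst S \<and> (\<forall>\<sigma>. substitution F ar V \<sigma> \<longrightarrow> Cn S (\<sigma> ` \<Sigma>) = fst S)"

definition right_companion ::
  "'f set \<Rightarrow> ('f \<Rightarrow> nat) \<Rightarrow> 'v set \<Rightarrow> ('f, 'v) fm logic \<Rightarrow> ('f, 'v) fm logic" where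
  "right_companion F ar V S =
     (fst S,
      {(\<Gamma>, \<alpha>). \<Gamma> \<subseteq> fst S \<and> \<alpha> \<in> fst S \<and>
         ((\<exists>\<Sigma>\<subseteq>\<Gamma>. antitheorem F ar V S \<Sigma>) \<or>
          (\<Gamma>, \<alpha>) \<in> snd S \<and> vars \<alpha> \<subseteq> vars_set \<Gamma>)})"

end

theory Submission
  imports Defs
begin

text \<open>Passing to the companion creates no new trivial sets: by
  \<open>trivial_set_if_trivial_set_right_companion\<close>, a set trivial in the companion is
  already trivial in \<open>S\<close>. Hence a formula \<alpha> that forms no trivial pair
  {\<alpha>, \<beta>} in \<open>S\<close> forms none in the companion, and the same \<alpha>
  witnesses NF-paraconsistency of both.\<close>

lemma substitution_id: "substitution F ar V id"
  by (simp add: substitution_def)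

text \<open>The identity is one of the substitutions quantified over.\<close>

lemma antitheorem_imp_trivial_set:
  assumes "antitheorem F ar V S \<Sigma>"
  shows "trivial_set S \<Sigma>"
proof -
  have "Cn S (id ` \<Sigma>) = fst S"
    using assms substitution_id unfolding antitheorem_def by blast
  then show ?thesis
    using assms by (simp add: antitheorem_def trivial_set_def)
qed

text \<open>An antitheorem inside \<Gamma> is trivial in \<open>S\<close>, and monotonicity lifts
  this to \<Gamma>. Without one, the companion derives from \<Gamma> only what \<open>S\<close>
  derives.\<close>

lemma trivial_set_if_trivial_set_right_companion:
  assumes "is_logic S" and "monotone_for_trivial_sets S"
    and "trivial_set (right_companion F ar V S) \<Gamma>"
  shows "trivial_set S \<Gamma>"
proof (cases "\<exists>\<Sigma>\<subseteq>\<Gamma>. antitheorem F ar V S \<Sigma>")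
  case True
  then obtain \<Sigma> where "\<Sigma> \<subseteq> \<Gamma>" and "trivial_set S \<Sigma>"
    using antitheorem_imp_trivial_set by blast
  moreover have "\<Gamma> \<subseteq> fst S"
    using assms(3) by (simp add: trivial_set_def right_companion_def)
  ultimately show ?thesis
    using assms(2) unfolding monotone_for_trivial_sets_def by blast
next
  case False
  \<comment> \<open>Only the second clause of the companion remains, so each formula is in
    \<open>Cn S \<Gamma>\<close>; \<open>is_logic\<close> gives the converse inclusion.\<close>
  then show ?thesis
    using assms(1,3)
    by (auto simp: trivial_set_def right_companion_def Cn_def is_logic_def)
qed

theorem theorem2p27:
  fixes F :: "'f set" and ar :: "'f \<Rightarrow> nat" and V :: "'v set"
    and S :: "('f, 'v) fm logic"
  assumes "finite F"
    and "countable V" and "infinite V"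
    and "fst S = formulas F ar V"
    and "is_logic S"
    and "monotone_for_trivial_sets S"
    and "NF_paraconsistent S"
  shows "NF_paraconsistent (right_companion F ar V S)"
proof -
  let ?R = "right_companion F ar V S"
  have fst_R: "fst ?R = fst S"
    by (simp add: right_companion_def)
  obtain \<alpha> where \<alpha>: "\<alpha> \<in> fst S" "\<And>\<beta>. \<beta> \<in> fst S \<Longrightarrow> Cn S {\<alpha>, \<beta>} \<noteq> fst S"
    using assms(7) unfolding NF_paraconsistent_def by blast
  \<comment> \<open>The witness \<alpha> for \<open>S\<close> is reused: a trivial pair in the
    companion would be trivial in \<open>S\<close>.\<close>
  have "Cn ?R {\<alpha>, \<beta>} \<noteq> fst ?R" if "\<beta> \<in> fst S" for \<beta>
  proof
    assume "Cn ?R {\<alpha>, \<beta>} = fst ?R"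
    then have "trivial_set ?R {\<alpha>, \<beta>}"
      using \<alpha>(1) that by (simp add: trivial_set_def fst_R)
    then have "trivial_set S {\<alpha>, \<beta>}"
      using assms(5,6) by (rule trivial_set_if_trivial_set_right_companion[rotated 2])
    then show False
      using \<alpha>(2)[OF that] by (simp add: trivial_set_def)
  qed
  then show ?thesis
    using \<alpha>(1) unfolding NF_paraconsistent_def fst_R by blast
qed

end
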